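(* For every integer $d\geq 1$, we have $$\frac{1}{2d+1}\leq\Delta_d^1\leq\frac{1}{d+2}.$$
   Context: Let $\mathbb{N}=\{0,1,2,\ldots\}$. For $\delta\in(0,1/2]$ let $\mathcal{K}_0(\delta)=[\delta,1-\delta]$ and, for an integer $d\ge 1$, $\mathcal{K}^d(\delta)=\bigcup_{k\in\mathbb{N}^d}\left(k+[\delta,1-\delta]^d\right)\subset\mathbb{R}^d$. For $A\subset\mathbb{R}^d$ and $B\subset(0,\infty)$, $A/B=\{(a_1/b,\ldots,a_d/b) : (a_1,\ldots,a_d)\in A,\ b\in B\}$. For every integer $d\ge 1$, the gap of loneliness in one round $\Delta_d^1$ is the supremum of all real numbers $\delta\in(0,1/2]$ such that $[1,\infty)^d\subset\mathcal{K}^d(\delta)/\mathcal{K}_0(\delta)$. *)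

theory Defs
  imports "HOL-Analysis.Finite_Cartesian_Product"
begin

text \<open>
  The space \<open>\<real>\<^sup>d\<close> is \<^typ>\<open>real ^ 'd\<close> with \<open>d = CARD('d)\<close>, so \<open>d \<ge> 1\<close> holds automatically.
\<close>

definition set_power :: "real set \<Rightarrow> (real ^ 'd::finite) set" where
  "set_power S = {x. \<forall>i. x $ i \<in> S}"

definition K0 :: "real \<Rightarrow> real set" where
  "K0 \<delta> = {\<delta>..1 - \<delta>}"

definition Kd :: "real \<Rightarrow> (real ^ 'd::finite) set" where
  "Kd \<delta> = (\<Union>k :: nat ^ 'd. (\<lambda>x. (\<chi> i. real (k $ i)) + x) ` set_power {\<delta>..1 - \<delta>})"

text \<open>The quotient \<open>A/B\<close> is only meant for \<open>B \<subseteq> {0<..}\<close>.\<close>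

definition set_quotient :: "(real ^ 'd::finite) set \<Rightarrow> real set \<Rightarrow> (real ^ 'd) set" where
  "set_quotient A B = {(\<chi> i. a $ i / b) | a b. a \<in> A \<and> b \<in> B}"

text \<open>
  The gap of loneliness in one round. The set is bounded above by \<open>1/2\<close>, so the real
  supremum is the intended one as soon as the set is nonempty.
\<close>

definition gap_one_round :: "'d::finite itself \<Rightarrow> real" where
  "gap_one_round _ =
     Sup {\<delta>. 0 < \<delta> \<and> \<delta> \<le> 1 / 2 \<and>
          (set_power {1..} :: (real ^ 'd) set) \<subseteq> set_quotient (Kd \<delta>) (K0 \<delta>)}"

end

theory Submission
  imports Defs
begin

text \<open>
  For \<open>\<delta> \<in> (0, 1/2]\<close>, the inclusion that defines the gap says the following: whenever \<open>d\<close>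
  runners have speeds \<open>x\<^sub>i \<ge> 1\<close>, there is a time \<open>t \<in> [\<delta>, 1 - \<delta>]\<close>, that is a moment in the
  first round of a runner of speed \<open>1\<close> at which that runner is at distance at least \<open>\<delta>\<close> from the
  integers, such that every \<open>t x\<^sub>i\<close> is at distance at least \<open>\<delta>\<close> from the integers too.

  The lower bound is a union bound on measures. Let \<open>\<delta> < 1 / (2 d + 1)\<close>, and let \<open>F y\<close> be the
  measure of the points of \<open>[0, y]\<close> within \<open>\<delta>\<close> of an integer. The runner of speed \<open>x\<close> is near an
  integer during a part of \<open>[\<delta>, 1 - \<delta>]\<close> of measure \<open>(F ((1 - \<delta>) x) - F (\<delta> x)) / x\<close>, and this is
  strictly less than \<open>(1 - 2 \<delta>) / d\<close> (lemma \<open>near_measure_window_less\<close>); hence \<open>d\<close> runners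
  cannot spoil the whole window. Runners of integer speed spend the time \<open>2 \<delta>\<close> of \<open>[0, 1]\<close> near
  integers, and comparing \<open>2 d \<delta>\<close> with \<open>1 - 2 \<delta>\<close> would only give \<open>1 / (2 d + 2)\<close>. What makes the
  constant \<open>2 d + 1\<close> come out is that for \<open>x \<ge> 2 d\<close> the fluctuation of \<open>F\<close> around its mean
  slope \<open>2 \<delta>\<close> is small compared to \<open>x\<close>, whereas for \<open>1 \<le> x \<le> 2 d\<close> the runner leaves the
  neighbourhood of its start before the window opens, so that an amount \<open>\<delta>\<close> of \<open>F\<close> is not counted.
  As \<open>F\<close> has a closed form, the union bound becomes a statement about increments of monotone
  functions (lemma \<open>increment_ge_if_covered\<close>).

  For the upper bound, take the speeds \<open>2, \<dots>, d + 1\<close>. By the sharp form of Dirichlet's theorem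
  (lemma \<open>Dirichlet_approx_sharp\<close>), at every time \<open>t\<close> one of \<open>t, 2 t, \<dots>, (d + 1) t\<close> is within
  \<open>1 / (d + 2)\<close> of an integer. If \<open>\<delta> > 1 / (d + 2)\<close>, then for \<open>t \<in> [\<delta>, 1 - \<delta>]\<close> it is not \<open>t\<close>
  itself, so it is one of the \<open>d\<close> runners.
\<close>

section \<open>Loneliness within one round\<close>

lemma mem_Kd_iff:
  fixes y :: "real ^ 'd::finite"
  shows "y \<in> Kd \<delta> \<longleftrightarrow> (\<forall>i. \<exists>k::nat. real k + \<delta> \<le> y $ i \<and> y $ i \<le> real k + 1 - \<delta>)"
proof
  assume "y \<in> Kd \<delta>"
  then obtain k :: "nat ^ 'd" and x where x: "x \<in> set_power {\<delta>..1 - \<delta>}"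
    and y: "y = (\<chi> i. real (k $ i)) + x"
    by (auto simp: Kd_def)
  have "real (k $ i) + \<delta> \<le> y $ i \<and> y $ i \<le> real (k $ i) + 1 - \<delta>" for i
    using x unfolding y by (auto simp: set_power_def algebra_simps dest!: spec[of _ i])
  then show "\<forall>i. \<exists>k::nat. real k + \<delta> \<le> y $ i \<and> y $ i \<le> real k + 1 - \<delta>"
    by blast
next
  assume "\<forall>i. \<exists>k::nat. real k + \<delta> \<le> y $ i \<and> y $ i \<le> real k + 1 - \<delta>"
  then obtain k where k: "\<And>i. real (k i) + \<delta> \<le> y $ i \<and> y $ i \<le> real (k i) + 1 - \<delta>"
    by metis
  let ?k = "(\<chi> i. k i) :: nat ^ 'd"
  have "y = (\<chi> i. real (?k $ i)) + (\<chi> i. y $ i - real (k i))"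
    by (simp add: vec_eq_iff)
  moreover have "(\<chi> i. y $ i - real (k i)) \<in> set_power {\<delta>..1 - \<delta>}"
    using k by (auto simp: set_power_def algebra_simps)
  ultimately show "y \<in> Kd \<delta>"
    unfolding Kd_def by blast
qed

lemma between_naturals_iff_far_from_integers:
  fixes y \<delta> :: real
  assumes "0 \<le> y" "0 < \<delta>"
  shows "(\<exists>k::nat. real k + \<delta> \<le> y \<and> y \<le> real k + 1 - \<delta>)
    \<longleftrightarrow> (\<forall>m::int. \<delta> \<le> \<bar>y - of_int m\<bar>)"
proof
  assume "\<exists>k::nat. real k + \<delta> \<le> y \<and> y \<le> real k + 1 - \<delta>"
  then obtain k :: nat where k: "real k + \<delta> \<le> y" "y \<le> real k + 1 - \<delta>" by blast
  show "\<forall>m::int. \<delta> \<le> \<bar>y - of_int m\<bar>"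
  proof
    fix m :: int
    consider "m \<le> int k" | "int k + 1 \<le> m" by linarith
    then show "\<delta> \<le> \<bar>y - of_int m\<bar>"
    proof cases
      case 1
      then have "real_of_int m \<le> real k" by linarith
      with k show ?thesis by linarith
    next
      case 2
      then have "real k + 1 \<le> real_of_int m" by linarith
      with k show ?thesis by linarith
    qed
  qed
next
  assume far: "\<forall>m::int. \<delta> \<le> \<bar>y - of_int m\<bar>"
  have "real (nat \<lfloor>y\<rfloor>) = of_int \<lfloor>y\<rfloor>" using assms by simp
  moreover have "\<delta> \<le> \<bar>y - of_int \<lfloor>y\<rfloor>\<bar>" "\<delta> \<le> \<bar>y - of_int (\<lfloor>y\<rfloor> + 1)\<bar>"
    using far by blast+
  moreover have "of_int \<lfloor>y\<rfloor> \<le> y" "y < of_int \<lfloor>y\<rfloor> + 1"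
    by linarith+
  ultimately have "real (nat \<lfloor>y\<rfloor>) + \<delta> \<le> y \<and> y \<le> real (nat \<lfloor>y\<rfloor>) + 1 - \<delta>"
    by (simp add: abs_if split: if_splits)
  then show "\<exists>k::nat. real k + \<delta> \<le> y \<and> y \<le> real k + 1 - \<delta>" by blast
qed

lemma one_round_inclusion_iff:
  assumes "0 < \<delta>"
  shows "(set_power {1..} :: (real ^ 'd::finite) set) \<subseteq> set_quotient (Kd \<delta>) (K0 \<delta>)
    \<longleftrightarrow> (\<forall>x :: 'd \<Rightarrow> real. (\<forall>i. 1 \<le> x i) \<longrightarrow>
          (\<exists>t. \<delta> \<le> t \<and> t \<le> 1 - \<delta> \<and> (\<forall>i. \<forall>m::int. \<delta> \<le> \<bar>t * x i - of_int m\<bar>)))"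
    (is "?L \<longleftrightarrow> ?R")
proof
  assume ?L
  show ?R
  proof (intro allI impI)
    fix x :: "'d \<Rightarrow> real"
    assume x: "\<forall>i. 1 \<le> x i"
    then have "(\<chi> i. x i) \<in> (set_power {1..} :: (real ^ 'd) set)"
      by (simp add: set_power_def)
    with \<open>?L\<close> have "(\<chi> i. x i) \<in> (set_quotient (Kd \<delta>) (K0 \<delta>) :: (real ^ 'd) set)" by blast
    then obtain a :: "real ^ 'd" and t where a: "a \<in> Kd \<delta>" and t: "t \<in> K0 \<delta>"
      and eq: "(\<chi> i. x i) = (\<chi> i. a $ i / t)"
      by (auto simp: set_quotient_def)
    have t': "\<delta> \<le> t" "t \<le> 1 - \<delta>" using t by (auto simp: K0_def)
    have "\<forall>m::int. \<delta> \<le> \<bar>t * x i - of_int m\<bar>" for i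
    proof -
      have "a $ i = t * x i"
        using eq t' assms by (simp add: vec_eq_iff)
      moreover have "0 \<le> t * x i"
        using t' assms order.trans[OF zero_le_one spec[OF x]] by simp
      ultimately show ?thesis
        using a assms between_naturals_iff_far_from_integers[of "t * x i" \<delta>] by (metis mem_Kd_iff)
    qed
    with t' show "\<exists>t. \<delta> \<le> t \<and> t \<le> 1 - \<delta> \<and> (\<forall>i. \<forall>m::int. \<delta> \<le> \<bar>t * x i - of_int m\<bar>)"
      by blast
  qed
next
  assume ?R
  show ?L
  proof
    fix x :: "real ^ 'd"
    assume "x \<in> set_power {1..}"
    then have x: "\<forall>i. 1 \<le> x $ i" by (simp add: set_power_def)
    with \<open>?R\<close> obtain t where t: "\<delta> \<le> t" "t \<le> 1 - \<delta>"
      and far: "\<forall>i. \<forall>m::int. \<delta> \<le> \<bar>t * x $ i - of_int m\<bar>"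
      by meson
    have "0 \<le> t * x $ i" for i
      using t assms order.trans[OF zero_le_one spec[OF x]] by simp
    then have "(\<chi> i. t * x $ i) \<in> Kd \<delta>"
      using far assms by (simp add: mem_Kd_iff between_naturals_iff_far_from_integers)
    moreover have "t \<in> K0 \<delta>" using t by (simp add: K0_def)
    moreover have "x = (\<chi> i. (\<chi> i. t * x $ i) $ i / t)"
      using t assms by (simp add: vec_eq_iff)
    ultimately show "x \<in> set_quotient (Kd \<delta>) (K0 \<delta>)"
      unfolding set_quotient_def by blast
  qed
qed

section \<open>The measure of the points near an integer\<close>

text \<open>
  For \<open>0 \<le> \<delta> \<le> 1/2\<close> and \<open>y \<ge> 0\<close> this is the Lebesgue measure of the set of \<open>s \<in> [0, y]\<close> at
  distance less than \<open>\<delta>\<close> from the integers: each of the \<open>round y\<close> unit intervals between \<open>0\<close> and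
  \<open>round y\<close> contributes \<open>2 \<delta>\<close>, and the truncated term is the signed contribution between \<open>round y\<close>
  and \<open>y\<close>.
\<close>

definition near_measure :: "real \<Rightarrow> real \<Rightarrow> real" where
  "near_measure \<delta> y = 2 * \<delta> * of_int (round y) + max (- \<delta>) (min \<delta> (y - of_int (round y)))"

lemma near_measure_eq_of_near:
  assumes "\<bar>y - of_int m\<bar> \<le> \<delta>" "\<delta> < 1/2"
  shows "near_measure \<delta> y = 2 * \<delta> * of_int m + (y - of_int m)"
proof -
  have "round y = m"
    using assms by (intro round_unique') auto
  then show ?thesis using assms by (simp add: near_measure_def)
qed

lemma near_measure_mono:
  assumes "y \<le> z" "0 \<le> \<delta>"
  shows "near_measure \<delta> y \<le> near_measure \<delta> z"
proof (cases "round y = round z")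
  case True
  then show ?thesis using assms by (auto simp: near_measure_def)
next
  case False
  with round_mono[OF assms(1)] have "round y + 1 \<le> round z" by linarith
  then have "of_int (round y) + 1 \<le> (of_int (round z) :: real)" by linarith
  then have "2 * \<delta> * (of_int (round y) + 1) \<le> 2 * \<delta> * of_int (round z)"
    using assms by (intro mult_left_mono) auto
  then show ?thesis
    using assms(2) by (simp add: near_measure_def algebra_simps)
qed

text \<open>
  The points near an integer have density \<open>2 \<delta>\<close>. The deviation from it is periodic and is extremal
  where \<open>y\<close> is at distance \<open>\<delta>\<close> from an integer.
\<close>

lemma near_measure_deviation:
  assumes "0 \<le> \<delta>" "\<delta> \<le> 1/2"
  shows "\<bar>near_measure \<delta> y - 2 * \<delta> * y\<bar> \<le> \<delta> * (1 - 2 * \<delta>)"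
proof -
  define r where "r = y - of_int (round y)"
  have r: "\<bar>r\<bar> \<le> 1/2"
    using of_int_round_abs_le[of y] by (simp add: r_def abs_minus_commute)
  have eq: "near_measure \<delta> y - 2 * \<delta> * y = max (- \<delta>) (min \<delta> r) - 2 * \<delta> * r"
    by (simp add: near_measure_def r_def algebra_simps)
  consider "r \<le> - \<delta>" | "\<bar>r\<bar> \<le> \<delta>" | "\<delta> \<le> r" by linarith
  then show ?thesis
  proof cases
    case 1
    have "2 * \<delta> * (- r) \<le> 2 * \<delta> * (1/2)" "2 * \<delta> * \<delta> \<le> 2 * \<delta> * (- r)"
      using 1 r assms by (intro mult_left_mono; simp)+
    moreover have "\<delta> * (2 * \<delta>) \<le> \<delta> * 1" using assms by (intro mult_left_mono) auto
    moreover have "max (- \<delta>) (min \<delta> r) = - \<delta>" using 1 assms by auto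
    ultimately show ?thesis unfolding eq by (simp add: algebra_simps abs_le_iff)
  next
    case 2
    have "r - 2 * \<delta> * r = r * (1 - 2 * \<delta>)" by (simp add: algebra_simps)
    then have "\<bar>r - 2 * \<delta> * r\<bar> = \<bar>r\<bar> * (1 - 2 * \<delta>)" using assms by (simp add: abs_mult)
    also have "\<dots> \<le> \<delta> * (1 - 2 * \<delta>)"
      using 2 assms by (intro mult_right_mono) auto
    finally have "\<bar>r - 2 * \<delta> * r\<bar> \<le> \<delta> * (1 - 2 * \<delta>)" .
    moreover have "max (- \<delta>) (min \<delta> r) = r" using 2 by auto
    ultimately show ?thesis unfolding eq by simp
  next
    case 3
    have "2 * \<delta> * r \<le> 2 * \<delta> * (1/2)" "2 * \<delta> * \<delta> \<le> 2 * \<delta> * r"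
      using 3 r assms by (intro mult_left_mono; simp)+
    moreover have "\<delta> * (2 * \<delta>) \<le> \<delta> * 1" using assms by (intro mult_left_mono) auto
    moreover have "max (- \<delta>) (min \<delta> r) = \<delta>" using 3 assms by auto
    ultimately show ?thesis unfolding eq by (simp add: algebra_simps abs_le_iff)
  qed
qed

text \<open>
  This is the estimate on which the constant \<open>2 d + 1\<close> depends. For \<open>x \<ge> 2 d\<close> the mean density with
  the worst deviation at both ends suffices. For \<open>x \<le> 2 d\<close> that error term is too large; but then
  the part up to \<open>\<delta> x \<ge> \<delta>\<close> contributes at least \<open>\<delta>\<close>, and the worst case is the one where the
  window closes just as the runner leaves the neighbourhood of its last integer \<open>k \<le> 2 d - 1\<close>.
\<close>

lemma near_measure_window_less:
  fixes d :: nat and x \<delta> :: real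
  assumes "1 \<le> d" "1 \<le> x" "0 < \<delta>" and \<delta>: "\<delta> * (2 * real d + 1) < 1"
  shows "real d * (near_measure \<delta> ((1 - \<delta>) * x) - near_measure \<delta> (\<delta> * x)) < (1 - 2 * \<delta>) * x"
proof -
  have d: "1 \<le> real d" using assms by simp
  have "\<delta> * 3 \<le> \<delta> * (2 * real d + 1)" using assms(3) d by (intro mult_left_mono) auto
  then have \<delta>3: "\<delta> < 1/3" using \<delta> by simp
  have d\<delta>: "2 * real d * \<delta> < 1 - \<delta>" using \<delta> by (simp add: algebra_simps)
  show ?thesis
  proof (cases "2 * real d \<le> x")
    case True
    have "near_measure \<delta> ((1 - \<delta>) * x) - near_measure \<delta> (\<delta> * x)
        \<le> 2 * \<delta> * ((1 - \<delta>) * x) - 2 * \<delta> * (\<delta> * x) + 2 * (\<delta> * (1 - 2 * \<delta>))"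
      using near_measure_deviation[of \<delta> "(1 - \<delta>) * x"] near_measure_deviation[of \<delta> "\<delta> * x"]
        assms(3) \<delta>3 by linarith
    also have "\<dots> = (2 * \<delta> * (x + 1)) * (1 - 2 * \<delta>)" by (simp add: algebra_simps)
    finally have "real d * (near_measure \<delta> ((1 - \<delta>) * x) - near_measure \<delta> (\<delta> * x))
        \<le> real d * ((2 * \<delta> * (x + 1)) * (1 - 2 * \<delta>))"
      using d by (intro mult_left_mono) auto
    also have "\<dots> = (2 * real d * \<delta> * (x + 1)) * (1 - 2 * \<delta>)" by (simp add: algebra_simps)
    also have "\<dots> < x * (1 - 2 * \<delta>)"
    proof (rule mult_strict_right_mono)
      have "\<delta> * (2 * real d * (x + 1)) \<le> \<delta> * ((2 * real d + 1) * x)"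
        using True assms(3) by (intro mult_left_mono) (auto simp: algebra_simps)
      also have "\<dots> = (\<delta> * (2 * real d + 1)) * x" by simp
      also have "\<dots> < 1 * x" using \<delta> assms(2) by (intro mult_strict_right_mono) auto
      finally show "2 * real d * \<delta> * (x + 1) < x" by (simp add: algebra_simps)
    qed (use \<delta>3 in simp)
    finally show ?thesis by (simp add: mult.commute)
  next
    case False
    define b where "b = (1 - \<delta>) * x"
    have start: "\<delta> \<le> near_measure \<delta> (\<delta> * x)"
      using near_measure_mono[of \<delta> "\<delta> * x" \<delta>] near_measure_eq_of_near[of \<delta> 0 \<delta>] assms \<delta>3 by simp
    have "b < (1 - \<delta>) * (2 * real d)"
      unfolding b_def using False \<delta>3 by (intro mult_strict_left_mono) auto
    then have b_less: "b < 2 * real d - 2 * real d * \<delta>" by (simp add: algebra_simps)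
    \<comment> \<open>\<open>k\<close> is the last integer whose neighbourhood begins before \<open>b\<close>, and \<open>e\<close> is the part of
      this neighbourhood that lies beyond \<open>b\<close>.\<close>
    define k where "k = (if b - of_int (round b) \<le> - \<delta> then round b - 1 else round b)"
    define e where "e = max 0 (of_int k + \<delta> - b)"
    have dist: "\<bar>b - of_int (round b)\<bar> \<le> 1/2"
      using of_int_round_abs_le[of b] by (simp add: abs_minus_commute)
    have "(1 - \<delta>) * 1 \<le> b" unfolding b_def using assms \<delta>3 by (intro mult_left_mono) auto
    then have "1/2 < b" using \<delta>3 by simp
    then have "0 < round b" using dist by linarith
    then have k0: "0 \<le> k" by (simp add: k_def)
    have "\<delta> * 1 \<le> 2 * real d * \<delta>" using d assms(3) by (simp add: mult.commute)
    moreover have "of_int (round b) \<le> b + 1/2" using dist by linarith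
    then have "of_int k \<le> b - 1/2 \<or> of_int k < b + \<delta>" by (auto simp: k_def)
    ultimately have "of_int k < 2 * real d" using b_less assms(3) by linarith
    then have "k < 2 * int d" by linarith
    then have k1: "of_int k \<le> 2 * real d - 1" by linarith
    have close: "near_measure \<delta> b = 2 * \<delta> * of_int k + \<delta> - e"
    proof (cases "b - of_int (round b) \<le> - \<delta>")
      case True
      then have k: "of_int (round b) = (of_int k + 1 :: real)" by (simp add: k_def)
      have "of_int k + \<delta> \<le> b" using dist \<delta>3 unfolding k by linarith
      then have "e = 0" by (simp add: e_def)
      moreover have "max (- \<delta>) (min \<delta> (b - of_int (round b))) = - \<delta>" using True assms(3) by linarith
      ultimately show ?thesis unfolding near_measure_def k by (simp add: algebra_simps)
    next
      case False
      then have k: "round b = k" by (simp add: k_def)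
      have "max (- \<delta>) (min \<delta> (b - of_int k)) = \<delta> - e"
        using False assms(3) unfolding e_def k by linarith
      then show ?thesis by (simp add: near_measure_def k)
    qed
    have "(1 - \<delta>) * (real d * (near_measure \<delta> b - near_measure \<delta> (\<delta> * x)))
        \<le> (1 - \<delta>) * (real d * (2 * \<delta> * of_int k - e))"
      using start close d \<delta>3 by (intro mult_left_mono) auto
    also have "\<dots> = (2 * real d * \<delta>) * ((1 - \<delta>) * of_int k) - (1 - \<delta>) * (real d * e)"
      by (simp add: algebra_simps)
    also have "\<dots> \<le> (1 - \<delta>) * ((1 - \<delta>) * of_int k) - (1 - \<delta>) * e"
    proof (intro diff_mono mult_right_mono mult_left_mono)
      show "e \<le> real d * e" using d by (simp add: e_def mult_le_cancel_right1)
    qed (use d\<delta> k0 \<delta>3 in auto)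
    also have "\<dots> < (1 - 2 * \<delta>) * (of_int k + \<delta> - e)"
    proof -
      have "\<delta> * of_int k \<le> \<delta> * (2 * real d - 1)"
        using k1 assms(3) by (intro mult_left_mono) auto
      also have "\<dots> < 1 - 2 * \<delta>" using \<delta> by (simp add: algebra_simps)
      finally have "\<delta> * (\<delta> * of_int k) < \<delta> * (1 - 2 * \<delta>)"
        using assms(3) by (intro mult_strict_left_mono)
      moreover have "0 \<le> \<delta> * e" using assms(3) by (simp add: e_def)
      ultimately show ?thesis by (simp add: algebra_simps)
    qed
    also have "\<dots> \<le> (1 - 2 * \<delta>) * b"
      using \<delta>3 by (intro mult_left_mono) (auto simp: e_def)
    also have "\<dots> = (1 - \<delta>) * ((1 - 2 * \<delta>) * x)" by (simp add: b_def)
    finally show ?thesis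
      using \<delta>3 by (simp add: b_def)
  qed
qed

section \<open>The lower bound\<close>

text \<open>
  A union bound for measures in the language of their distribution functions: if every point of
  an interval has a neighbourhood on which some member of a family of nondecreasing functions
  grows with slope \<open>1\<close>, then the increments of the family add up to at least the length. The
  inequality is additive under concatenation of intervals, so bisection reduces it to small ones.
\<close>

lemma increment_ge_if_covered:
  fixes G :: "'i \<Rightarrow> real \<Rightarrow> real"
  assumes "finite I" "a \<le> b"
    and mono: "\<And>i. i \<in> I \<Longrightarrow> mono (G i)"
    and cover: "\<And>t. a \<le> t \<Longrightarrow> t \<le> b \<Longrightarrow>
      \<exists>i\<in>I. \<exists>e>0. \<forall>u v. \<bar>u - t\<bar> < e \<longrightarrow> \<bar>v - t\<bar> < e \<longrightarrow> G i v - G i u = v - u"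
  shows "b - a \<le> (\<Sum>i\<in>I. G i b - G i a)"
  using \<open>a \<le> b\<close>
proof (induction rule: Bolzano)
  case (trans u v w)
  then show ?case by (simp add: sum_subtractf)
next
  case (local t)
  then obtain i e where i: "i \<in> I" "e > 0"
    and slope: "\<And>u v. \<bar>u - t\<bar> < e \<Longrightarrow> \<bar>v - t\<bar> < e \<Longrightarrow> G i v - G i u = v - u"
    using cover by meson
  have "v - u \<le> (\<Sum>i\<in>I. G i v - G i u)" if "u \<le> t \<and> t \<le> v \<and> v - u < e" for u v
  proof -
    have "v - u = (\<Sum>j\<in>{i}. G j v - G j u)" using that by (simp add: slope)
    also have "\<dots> \<le> (\<Sum>i\<in>I. G i v - G i u)"
      using that i mono \<open>finite I\<close> by (intro sum_mono2) (auto intro: monoD[OF mono])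
    finally show ?thesis .
  qed
  with i show ?case by blast
qed

lemma exists_lonely_time:
  fixes x :: "'d::finite \<Rightarrow> real"
  assumes x: "\<And>i. 1 \<le> x i" and "0 < \<delta>" and \<delta>: "\<delta> * (2 * real CARD('d) + 1) < 1"
  shows "\<exists>t. \<delta> \<le> t \<and> t \<le> 1 - \<delta> \<and> (\<forall>i. \<forall>m::int. \<delta> \<le> \<bar>t * x i - of_int m\<bar>)"
proof (rule ccontr)
  assume no_time: "\<not> ?thesis"
  let ?G = "\<lambda>i t. near_measure \<delta> (t * x i) / x i"
  have card: "1 \<le> CARD('d)" by (simp add: Suc_le_eq)
  then have "\<delta> * 3 \<le> \<delta> * (2 * real CARD('d) + 1)"
    using \<open>0 < \<delta>\<close> by (intro mult_left_mono) auto
  then have \<delta>3: "\<delta> < 1/3" using \<delta> by simp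
  have xpos: "0 < x i" for i using x[of i] by linarith
  have "1 - \<delta> - \<delta> \<le> (\<Sum>i\<in>UNIV. ?G i (1 - \<delta>) - ?G i \<delta>)"
  proof (rule increment_ge_if_covered)
    show "mono (?G i)" for i
      using xpos[of i] \<open>0 < \<delta>\<close>
      by (intro monoI divide_right_mono near_measure_mono mult_right_mono) auto
    fix t assume "\<delta> \<le> t" "t \<le> 1 - \<delta>"
    with no_time obtain i and m :: int where near: "\<bar>t * x i - of_int m\<bar> < \<delta>"
      by (meson not_le)
    define e where "e = (\<delta> - \<bar>t * x i - of_int m\<bar>) / x i"
    have "0 < e" using near xpos by (simp add: e_def)
    have local_form: "?G i u = 2 * \<delta> * of_int m / x i + u - of_int m / x i" if "\<bar>u - t\<bar> < e" for u
    proof -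
      have "\<bar>u - t\<bar> * x i < e * x i" using that xpos by (intro mult_strict_right_mono)
      also have "e * x i = \<delta> - \<bar>t * x i - of_int m\<bar>" using xpos[of i] by (simp add: e_def)
      also have "\<bar>u - t\<bar> * x i = \<bar>u * x i - t * x i\<bar>"
        using xpos[of i] by (metis abs_mult abs_of_pos left_diff_distrib)
      finally have "\<bar>u * x i - of_int m\<bar> \<le> \<delta>" by linarith
      then have "near_measure \<delta> (u * x i) = 2 * \<delta> * of_int m + (u * x i - of_int m)"
        using \<delta>3 by (intro near_measure_eq_of_near) auto
      then show ?thesis using xpos[of i] by (simp add: add_divide_distrib diff_divide_distrib)
    qed
    show "\<exists>i\<in>UNIV. \<exists>e>0. \<forall>u v. \<bar>u - t\<bar> < e \<longrightarrow> \<bar>v - t\<bar> < e \<longrightarrow> ?G i v - ?G i u = v - u"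
    proof (intro bexI exI conjI allI impI)
      show "?G i v - ?G i u = v - u" if "\<bar>u - t\<bar> < e" "\<bar>v - t\<bar> < e" for u v
        using local_form[OF that(1)] local_form[OF that(2)] by simp
    qed (use \<open>0 < e\<close> in auto)
  qed (use \<delta>3 in auto)
  moreover have "(\<Sum>i\<in>UNIV. ?G i (1 - \<delta>) - ?G i \<delta>)
      < (\<Sum>i\<in>(UNIV :: 'd set). (1 - 2 * \<delta>) / real CARD('d))"
  proof (rule sum_strict_mono)
    fix i
    have "real CARD('d) * (near_measure \<delta> ((1 - \<delta>) * x i) - near_measure \<delta> (\<delta> * x i))
        < (1 - 2 * \<delta>) * x i"
      using card x \<open>0 < \<delta>\<close> \<delta> by (rule near_measure_window_less)
    then show "?G i (1 - \<delta>) - ?G i \<delta> < (1 - 2 * \<delta>) / real CARD('d)"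
      using xpos[of i] card by (simp add: field_simps)
  qed auto
  ultimately show False by simp
qed

section \<open>The upper bound\<close>

text \<open>
  The pigeonhole argument with \<open>n + 1\<close> boxes of length \<open>1 / (n + 1)\<close> for the \<open>n + 1\<close> fractional
  parts of \<open>0, t, \<dots>, n t\<close>. Either two of them share a box, or every box is hit. The last box is
  then hit by some \<open>q t\<close>, which lies within \<open>1 / (n + 1)\<close> of the next integer; as \<open>0\<close> lies in the
  first box, \<open>q \<noteq> 0\<close>. This second alternative is what improves \<open>1 / n\<close> to \<open>1 / (n + 1)\<close>.
\<close>

lemma Dirichlet_approx_sharp:
  fixes t :: real and n :: nat
  assumes "1 \<le> n"
  obtains q :: nat and m :: int
  where "1 \<le> q" "q \<le> n" "\<bar>real q * t - of_int m\<bar> \<le> 1 / (real n + 1)"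
proof -
  define box where "box j = \<lfloor>(real n + 1) * frac (real j * t)\<rfloor>" for j :: nat
  have box_bounds: "of_int (box j) \<le> (real n + 1) * frac (real j * t)"
    "(real n + 1) * frac (real j * t) < of_int (box j) + 1" for j
    unfolding box_def by linarith+
  have range: "box ` {0..n} \<subseteq> {0..int n}"
  proof
    fix c assume "c \<in> box ` {0..n}"
    then obtain j where c: "c = box j" by blast
    have "(real n + 1) * frac (real j * t) < (real n + 1) * 1"
      by (intro mult_strict_left_mono frac_lt_1) auto
    then have "box j < int n + 1" unfolding box_def floor_less_iff by simp
    moreover have "0 \<le> box j" by (simp add: box_def frac_ge_0)
    ultimately show "c \<in> {0..int n}" by (simp add: c)
  qed
  show thesis
  proof (cases "inj_on box {0..n}")
    case True
    then have "card (box ` {0..n}) = card {0..int n}" by (simp add: card_image)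
    with range have "box ` {0..n} = {0..int n}" by (intro card_subset_eq) auto
    then have "int n \<in> box ` {0..n}" by simp
    then obtain q where q: "q \<le> n" "box q = int n" by auto
    have "q \<noteq> 0"
    proof
      assume "q = 0"
      then have "box q = 0" by (simp add: box_def)
      with q assms show False by simp
    qed
    have "real n \<le> (real n + 1) * frac (real q * t)" using box_bounds(1)[of q] q by simp
    then have "1 - frac (real q * t) \<le> 1 / (real n + 1)" by (simp add: field_simps)
    moreover have "frac (real q * t) < 1" by (rule frac_lt_1)
    ultimately have "\<bar>real q * t - of_int (\<lfloor>real q * t\<rfloor> + 1)\<bar> \<le> 1 / (real n + 1)"
      by (simp add: frac_def)
    then show thesis using q \<open>q \<noteq> 0\<close> by (intro that[of q "\<lfloor>real q * t\<rfloor> + 1"]) auto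
  next
    case False
    then obtain i j where "i \<in> {0..n}" "j \<in> {0..n}" "i \<noteq> j" "box i = box j"
      by (auto simp: inj_on_def)
    then obtain i j where ij: "i < j" "j \<le> n" "box i = box j"
      by (cases i j rule: linorder_cases) auto
    have "\<bar>(real n + 1) * (frac (real j * t) - frac (real i * t))\<bar> < 1"
      using box_bounds[of i] box_bounds[of j] ij(3) unfolding right_diff_distrib by linarith
    then have "(real n + 1) * \<bar>frac (real j * t) - frac (real i * t)\<bar> < 1"
      by (simp add: abs_mult)
    then have "\<bar>frac (real j * t) - frac (real i * t)\<bar> \<le> 1 / (real n + 1)"
      by (simp add: field_simps)
    also have "frac (real j * t) - frac (real i * t)
        = real (j - i) * t - of_int (\<lfloor>real j * t\<rfloor> - \<lfloor>real i * t\<rfloor>)"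
      using ij(1) by (simp add: frac_def of_nat_diff algebra_simps)
    finally show thesis using ij by (intro that[of "j - i" "\<lfloor>real j * t\<rfloor> - \<lfloor>real i * t\<rfloor>"]) auto
  qed
qed

lemma exists_speeds_without_lonely_time:
  assumes "1 / (real CARD('d::finite) + 2) < \<delta>"
  shows "\<exists>x :: 'd \<Rightarrow> real. (\<forall>i. 1 \<le> x i) \<and>
    (\<forall>t. \<delta> \<le> t \<longrightarrow> t \<le> 1 - \<delta> \<longrightarrow> (\<exists>i. \<exists>m::int. \<bar>t * x i - of_int m\<bar> < \<delta>))"
proof -
  obtain h :: "'d \<Rightarrow> nat" where h: "bij_betw h UNIV {0..<CARD('d)}"
    using ex_bij_betw_finite_nat[of "UNIV :: 'd set"] by auto
  have "\<exists>i. \<exists>m::int. \<bar>t * (real (h i) + 2) - of_int m\<bar> < \<delta>" if t: "\<delta> \<le> t" "t \<le> 1 - \<delta>" for t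
  proof -
    obtain q :: nat and m :: int where q: "1 \<le> q" "q \<le> CARD('d) + 1"
      and "\<bar>real q * t - of_int m\<bar> \<le> 1 / (real (CARD('d) + 1) + 1)"
      using Dirichlet_approx_sharp[of "CARD('d) + 1" t] by auto
    then have near: "\<bar>real q * t - of_int m\<bar> < \<delta>" using assms by (simp add: add.commute)
    \<comment> \<open>The time window keeps the runner of speed \<open>1\<close> away from the integers.\<close>
    have "q \<noteq> 1"
    proof
      assume "q = 1"
      with near have "\<bar>t - of_int m\<bar> < \<delta>" by simp
      with t have "0 < real_of_int m" "real_of_int m < 1" by (auto simp: abs_less_iff)
      then show False by simp
    qed
    with q have "q - 2 \<in> {0..<CARD('d)}" by auto
    then obtain i where "h i = q - 2" using h by (metis bij_betw_imp_surj_on imageE)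
    with q \<open>q \<noteq> 1\<close> have "real (h i) + 2 = real q" by (simp add: of_nat_diff)
    with near show ?thesis by (metis mult.commute)
  qed
  then show ?thesis by (intro exI[of _ "\<lambda>i. real (h i) + 2"]) auto
qed

theorem proposition1:
  shows "1 / (2 * real CARD('d::finite) + 1) \<le> gap_one_round TYPE('d)
       \<and> gap_one_round TYPE('d) \<le> 1 / (real CARD('d) + 2)"
proof -
  define S where "S = {\<delta>. 0 < \<delta> \<and> \<delta> \<le> 1 / 2 \<and>
    (set_power {1..} :: (real ^ 'd) set) \<subseteq> set_quotient (Kd \<delta>) (K0 \<delta>)}"
  let ?c = "1 / (2 * real CARD('d) + 1)"
  have gap: "gap_one_round TYPE('d) = Sup S" by (simp add: gap_one_round_def S_def)
  have "bdd_above S" by (auto simp: S_def intro!: bdd_aboveI[of _ "1/2"])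
  have mem: "\<delta> \<in> S" if \<delta>: "0 < \<delta>" "\<delta> < ?c" for \<delta>
  proof -
    have "\<delta> * (2 * real CARD('d) + 1) < 1" using \<delta>(2) by (simp add: field_simps)
    moreover have "0 < CARD('d)" by simp
    then have "2 \<le> 2 * real CARD('d) + 1" by linarith
    then have "?c \<le> 1/2" by (rule divide_left_mono) auto
    with \<delta>(2) have "\<delta> \<le> 1/2" by linarith
    ultimately show ?thesis
      using \<delta> exists_lonely_time[where 'd = 'd, OF _ \<delta>(1)]
      by (auto simp: S_def one_round_inclusion_iff)
  qed
  have "0 < ?c" by (simp add: add_nonneg_pos)
  have "?c \<le> Sup S"
  proof (rule dense_le_bounded[OF \<open>0 < ?c\<close>])
    show "\<delta> \<le> Sup S" if "0 < \<delta>" "\<delta> < ?c" for \<delta>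
      using mem[OF that] \<open>bdd_above S\<close> by (rule cSup_upper)
  qed
  moreover have "Sup S \<le> 1 / (real CARD('d) + 2)"
  proof (rule cSup_least)
    obtain \<delta> where "0 < \<delta>" "\<delta> < ?c" using dense[OF \<open>0 < ?c\<close>] by blast
    then show "S \<noteq> {}" using mem by blast
    fix \<delta> assume "\<delta> \<in> S"
    show "\<delta> \<le> 1 / (real CARD('d) + 2)"
    proof (rule ccontr)
      assume "\<not> ?thesis"
      then obtain x :: "'d \<Rightarrow> real" where "\<forall>i. 1 \<le> x i"
        and "\<forall>t. \<delta> \<le> t \<longrightarrow> t \<le> 1 - \<delta> \<longrightarrow> (\<exists>i. \<exists>m::int. \<bar>t * x i - of_int m\<bar> < \<delta>)"
        using exists_speeds_without_lonely_time[where 'd = 'd, of \<delta>] by auto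
      with \<open>\<delta> \<in> S\<close> show False
        unfolding S_def by (auto simp: one_round_inclusion_iff) (meson not_le)
    qed
  qed
  ultimately show ?thesis by (simp add: gap)
qed

end
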